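(* Let $(E,\Gamma,I,S)$ be a shrinking nondegenerate game played on a complete metric space $(X,d)$. If Alice (resp. Bob) has a winning strategy for the $(E,\Gamma,I,S)$-game, then $S$ (resp. $X\setminus S$) contains a closed perfect set. In particular, if $S$ is a Bernstein set then the $(E,\Gamma,I,S)$-game is undetermined.
   Context: Let $E$ be a nonempty set; $E^*$ and $E^{\mathbb{N}}$ denote finite and infinite words over $E$, and $\omega\preceq\tau$ means $\tau$ extends $\omega$. A ruleset $\Gamma$ assigns to each finite word $(\omega_1,\ldots,\omega_{n-1})$ (including the empty word) a nonempty subset of $E$. A word $\omega$ is legal if $\omega_n\in\Gamma(\omega_1,\ldots,\omega_{n-1})$ for all $n\le|\omega|$; $E_\Gamma^*$, $E_\Gamma^{\mathbb{N}}$ denote finite and infinite legal words. A topological interpretation is a map $I:E_\Gamma^*\to\mathcal{K}^*(X)$ (nonempty closed subsets of $X$) with $\omega\preceq\tau\Rightarrow I(\tau)\subset I(\omega)$; for $\omega\in E_\Gamma^{\mathbb{N}}$, $I(\omega)=\bigcap_{n\ge0}I(\omega_1,\ldots,\omega_n)$. For $S\subset X$, in the $(E,\Gamma,I,S)$-game Alice and Bob alternately choose $\omega_1,\omega_2,\ldots$ (Bob the odd-indexed, Alice the even-indexed entries) keeping all prefixes legal; Alice wins iff $I(\omega)\cap S\ne\emptyset$. An Alice-strategy is a map $\sigma_A$ on legal words of odd length with $\sigma_A(\omega)\in\Gamma(\omega)$; a Bob-strategy is a map $\sigma_B$ on legal words of even length (including empty) with $\sigma_B(\omega)\in\Gamma(\omega)$.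 Given $\tau\in E_\Gamma^*$ and strategies $\sigma_A,\sigma_B$, $(\tau,\sigma_A,\sigma_B)$ denotes the unique infinite play extending $\tau$ in which every move after position $|\tau|$ is given by $\sigma_A$ (even positions) or $\sigma_B$ (odd positions). For a set $\mathcal{T}\subset E_\Gamma^{\mathbb{N}}$, an Alice-strategy $\sigma_A$ ensures $\phi\in\mathcal{T}$ assuming $\phi\succeq\tau$ if $(\tau,\sigma_A,\sigma_B)\in\mathcal{T}$ for every Bob-strategy $\sigma_B$; similarly for Bob-strategies. A strategy is winning if every play consistent with it (from the start) is won by that player; the game is determined if some player has a winning strategy. Let $Z=\{\omega\in E_\Gamma^{\mathbb{N}}:\operatorname{diam}(I(\omega_1,\ldots,\omega_n))\to0\}$ and, for $x\in X$, $N_x=\{\omega\in E_\Gamma^{\mathbb{N}}: x\notin I(\omega)\}$. The game is shrinking if for every $\omega\in E_\Gamma^*$ each player has a strategy ensuring $\phi\in Z$ assuming $\phi\succeq\omega$. The game is nondegenerate if for every $\omega\in E_\Gamma^*$ and every $x\in X$ each player has a strategy ensuring $\phi\in N_x$ assuming $\phi\succeq\omega$. A Bernstein set is a set $S\subset X$ such that every closed perfect subset of $X$ meets both $S$ and $X\setminus S$. *)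

theory Defs
  imports "HOL-Analysis.Analysis" "HOL-Library.Sublist"
begin

(* Finite words over E are lists in lists E, infinite words are functions nat => 'e with values
   in E.  Entries are indexed from 0, so Bob chooses the entries with even index (he moves at
   words of even length, in particular first) and Alice those with odd index.  The space X is
   the whole type 'x. *)

definition ruleset :: "'e set \<Rightarrow> ('e list \<Rightarrow> 'e set) \<Rightarrow> bool" where
  "ruleset E \<Gamma> \<longleftrightarrow> (\<forall>w\<in>lists E. \<Gamma> w \<noteq> {} \<and> \<Gamma> w \<subseteq> E)"

definition legal_words :: "'e set \<Rightarrow> ('e list \<Rightarrow> 'e set) \<Rightarrow> 'e list set" where
  "legal_words E \<Gamma> = {w \<in> lists E. \<forall>n<length w. w ! n \<in> \<Gamma> (take n w)}"

definition initial :: "(nat \<Rightarrow> 'e) \<Rightarrow> nat \<Rightarrow> 'e list" where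
  "initial \<omega> n = map \<omega> [0..<n]"

definition legal_inf_words :: "'e set \<Rightarrow> ('e list \<Rightarrow> 'e set) \<Rightarrow> (nat \<Rightarrow> 'e) set" where
  "legal_inf_words E \<Gamma> = {\<omega>. range \<omega> \<subseteq> E \<and> (\<forall>n. \<omega> n \<in> \<Gamma> (initial \<omega> n))}"

definition topological_interpretation ::
    "'e set \<Rightarrow> ('e list \<Rightarrow> 'e set) \<Rightarrow> ('e list \<Rightarrow> 'x::topological_space set) \<Rightarrow> bool" where
  "topological_interpretation E \<Gamma> I \<longleftrightarrow>
     (\<forall>w\<in>legal_words E \<Gamma>. closed (I w) \<and> I w \<noteq> {}) \<and>
     (\<forall>v\<in>legal_words E \<Gamma>. \<forall>w\<in>legal_words E \<Gamma>. prefix v w \<longrightarrow> I w \<subseteq> I v)"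

definition outcome :: "('e list \<Rightarrow> 'x set) \<Rightarrow> (nat \<Rightarrow> 'e) \<Rightarrow> 'x set" where
  "outcome I \<omega> = (\<Inter>n. I (initial \<omega> n))"

definition game :: "'e set \<Rightarrow> ('e list \<Rightarrow> 'e set) \<Rightarrow> ('e list \<Rightarrow> 'x::topological_space set) \<Rightarrow> bool" where
  "game E \<Gamma> I \<longleftrightarrow> E \<noteq> {} \<and> ruleset E \<Gamma> \<and> topological_interpretation E \<Gamma> I"

(* Strategies are total functions on lists; their values at words that are not legal, or at
   which the other player is to move, are never used. *)

definition alice_strategy :: "'e set \<Rightarrow> ('e list \<Rightarrow> 'e set) \<Rightarrow> ('e list \<Rightarrow> 'e) \<Rightarrow> bool" where
  "alice_strategy E \<Gamma> \<sigma> \<longleftrightarrow> (\<forall>w\<in>legal_words E \<Gamma>. odd (length w) \<longrightarrow> \<sigma> w \<in> \<Gamma> w)"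

definition bob_strategy :: "'e set \<Rightarrow> ('e list \<Rightarrow> 'e set) \<Rightarrow> ('e list \<Rightarrow> 'e) \<Rightarrow> bool" where
  "bob_strategy E \<Gamma> \<sigma> \<longleftrightarrow> (\<forall>w\<in>legal_words E \<Gamma>. even (length w) \<longrightarrow> \<sigma> w \<in> \<Gamma> w)"

primrec play_steps :: "'e list \<Rightarrow> ('e list \<Rightarrow> 'e) \<Rightarrow> ('e list \<Rightarrow> 'e) \<Rightarrow> nat \<Rightarrow> 'e list" where
  "play_steps \<tau> \<sigma>A \<sigma>B 0 = \<tau>"
| "play_steps \<tau> \<sigma>A \<sigma>B (Suc n) =
     (let w = play_steps \<tau> \<sigma>A \<sigma>B n in w @ [if even (length w) then \<sigma>B w else \<sigma>A w])"

(* The word after k + 1 further moves has length at least k + 1, so entry k is defined. *)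
definition play :: "'e list \<Rightarrow> ('e list \<Rightarrow> 'e) \<Rightarrow> ('e list \<Rightarrow> 'e) \<Rightarrow> nat \<Rightarrow> 'e" where
  "play \<tau> \<sigma>A \<sigma>B = (\<lambda>k. play_steps \<tau> \<sigma>A \<sigma>B (Suc k) ! k)"

definition alice_ensures ::
    "'e set \<Rightarrow> ('e list \<Rightarrow> 'e set) \<Rightarrow> ('e list \<Rightarrow> 'e) \<Rightarrow> (nat \<Rightarrow> 'e) set \<Rightarrow> 'e list \<Rightarrow> bool" where
  "alice_ensures E \<Gamma> \<sigma>A T \<tau> \<longleftrightarrow> (\<forall>\<sigma>B. bob_strategy E \<Gamma> \<sigma>B \<longrightarrow> play \<tau> \<sigma>A \<sigma>B \<in> T)"

definition bob_ensures ::
    "'e set \<Rightarrow> ('e list \<Rightarrow> 'e set) \<Rightarrow> ('e list \<Rightarrow> 'e) \<Rightarrow> (nat \<Rightarrow> 'e) set \<Rightarrow> 'e list \<Rightarrow> bool" where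
  "bob_ensures E \<Gamma> \<sigma>B T \<tau> \<longleftrightarrow> (\<forall>\<sigma>A. alice_strategy E \<Gamma> \<sigma>A \<longrightarrow> play \<tau> \<sigma>A \<sigma>B \<in> T)"

definition both_can_ensure ::
    "'e set \<Rightarrow> ('e list \<Rightarrow> 'e set) \<Rightarrow> (nat \<Rightarrow> 'e) set \<Rightarrow> 'e list \<Rightarrow> bool" where
  "both_can_ensure E \<Gamma> T \<tau> \<longleftrightarrow>
     (\<exists>\<sigma>A. alice_strategy E \<Gamma> \<sigma>A \<and> alice_ensures E \<Gamma> \<sigma>A T \<tau>) \<and>
     (\<exists>\<sigma>B. bob_strategy E \<Gamma> \<sigma>B \<and> bob_ensures E \<Gamma> \<sigma>B T \<tau>)"

definition alice_winning ::
    "'e set \<Rightarrow> ('e list \<Rightarrow> 'e set) \<Rightarrow> ('e list \<Rightarrow> 'x set) \<Rightarrow> 'x set \<Rightarrow> ('e list \<Rightarrow> 'e) \<Rightarrow> bool" where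
  "alice_winning E \<Gamma> I S \<sigma>A \<longleftrightarrow> alice_strategy E \<Gamma> \<sigma>A \<and>
     (\<forall>\<omega>\<in>legal_inf_words E \<Gamma>.
        (\<forall>n. odd n \<longrightarrow> \<omega> n = \<sigma>A (initial \<omega> n)) \<longrightarrow> outcome I \<omega> \<inter> S \<noteq> {})"

definition bob_winning ::
    "'e set \<Rightarrow> ('e list \<Rightarrow> 'e set) \<Rightarrow> ('e list \<Rightarrow> 'x set) \<Rightarrow> 'x set \<Rightarrow> ('e list \<Rightarrow> 'e) \<Rightarrow> bool" where
  "bob_winning E \<Gamma> I S \<sigma>B \<longleftrightarrow> bob_strategy E \<Gamma> \<sigma>B \<and>
     (\<forall>\<omega>\<in>legal_inf_words E \<Gamma>.
        (\<forall>n. even n \<longrightarrow> \<omega> n = \<sigma>B (initial \<omega> n)) \<longrightarrow> \<not> (outcome I \<omega> \<inter> S \<noteq> {}))"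

definition determined ::
    "'e set \<Rightarrow> ('e list \<Rightarrow> 'e set) \<Rightarrow> ('e list \<Rightarrow> 'x set) \<Rightarrow> 'x set \<Rightarrow> bool" where
  "determined E \<Gamma> I S \<longleftrightarrow>
     (\<exists>\<sigma>A. alice_winning E \<Gamma> I S \<sigma>A) \<or> (\<exists>\<sigma>B. bob_winning E \<Gamma> I S \<sigma>B)"

(* The library's real-valued diameter is unspecified on unbounded sets, whose diameter is
   infinite in the mathematics; hence the eventual boundedness, which is part of "diam -> 0". *)
definition Z_set ::
    "'e set \<Rightarrow> ('e list \<Rightarrow> 'e set) \<Rightarrow> ('e list \<Rightarrow> 'x::metric_space set) \<Rightarrow> (nat \<Rightarrow> 'e) set" where
  "Z_set E \<Gamma> I = {\<omega> \<in> legal_inf_words E \<Gamma>.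
     (\<forall>\<^sub>F n in sequentially. bounded (I (initial \<omega> n))) \<and>
     (\<lambda>n. diameter (I (initial \<omega> n))) \<longlonglongrightarrow> 0}"

definition N_set ::
    "'e set \<Rightarrow> ('e list \<Rightarrow> 'e set) \<Rightarrow> ('e list \<Rightarrow> 'x set) \<Rightarrow> 'x \<Rightarrow> (nat \<Rightarrow> 'e) set" where
  "N_set E \<Gamma> I x = {\<omega> \<in> legal_inf_words E \<Gamma>. x \<notin> outcome I \<omega>}"

definition shrinking ::
    "'e set \<Rightarrow> ('e list \<Rightarrow> 'e set) \<Rightarrow> ('e list \<Rightarrow> 'x::metric_space set) \<Rightarrow> bool" where
  "shrinking E \<Gamma> I \<longleftrightarrow> (\<forall>w\<in>legal_words E \<Gamma>. both_can_ensure E \<Gamma> (Z_set E \<Gamma> I) w)"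

definition nondegenerate ::
    "'e set \<Rightarrow> ('e list \<Rightarrow> 'e set) \<Rightarrow> ('e list \<Rightarrow> 'x set) \<Rightarrow> bool" where
  "nondegenerate E \<Gamma> I \<longleftrightarrow>
     (\<forall>w\<in>legal_words E \<Gamma>. \<forall>x. both_can_ensure E \<Gamma> (N_set E \<Gamma> I x) w)"

(* Perfect sets are nonempty by convention; otherwise no set would be Bernstein and every
   set would contain a closed perfect set. *)
definition closed_perfect :: "'x::topological_space set \<Rightarrow> bool" where
  "closed_perfect P \<longleftrightarrow> P \<noteq> {} \<and> closed P \<and> (\<forall>x\<in>P. x islimpt P)"

definition bernstein :: "'x::topological_space set \<Rightarrow> bool" where
  "bernstein S \<longleftrightarrow> (\<forall>P. closed_perfect P \<longrightarrow> P \<inter> S \<noteq> {} \<and> P \<inter> (UNIV - S) \<noteq> {})"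

end

theory Submission
  imports Defs
begin

text \<open>
  Fix a winning strategy and consider the tree of legal words consistent with it. Letting the
  opponent use a strategy ensuring shrinking, any word of the tree extends to a play of the tree
  with a single outcome \<open>x\<close>; letting him then use a strategy avoiding \<open>x\<close>, the same word extends
  to a second word of the tree whose set misses \<open>x\<close>. Hence every word of the tree has two
  extensions in the tree with disjoint sets of arbitrarily small diameter. Iterating this gives
  a Cantor scheme whose branches are plays consistent with the winning strategy; its limit set
  is closed and perfect, and each of its points is the outcome of such a play.
\<close>

section \<open>Initial segments of an infinite word\<close>

lemma length_initial [simp]: "length (initial \<omega> n) = n"
  by (simp add: initial_def)

lemma initial_0 [simp]: "initial \<omega> 0 = []"
  by (simp add: initial_def)

lemma initial_Suc: "initial \<omega> (Suc n) = initial \<omega> n @ [\<omega> n]"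
  by (simp add: initial_def)

lemma nth_initial [simp]: "k < n \<Longrightarrow> initial \<omega> n ! k = \<omega> k"
  by (simp add: initial_def)

lemma take_initial: "m \<le> n \<Longrightarrow> take m (initial \<omega> n) = initial \<omega> m"
  by (simp add: list_eq_iff_nth_eq)

lemma prefix_initial: "m \<le> n \<Longrightarrow> prefix (initial \<omega> m) (initial \<omega> n)"
  by (metis take_initial take_is_prefix)

lemma initial_cong: "(\<And>k. k < n \<Longrightarrow> \<omega> k = \<omega>' k) \<Longrightarrow> initial \<omega> n = initial \<omega>' n"
  by (simp add: list_eq_iff_nth_eq)

subsection \<open>Cantor schemes\<close>

text \<open>The smallness condition concerns only nonempty index words, so the root set
  \<open>F []\<close> may be unbounded.\<close>

locale cantor_scheme =
  fixes F :: "bool list \<Rightarrow> 'x::complete_space set"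
  assumes closed_F: "closed (F s)"
    and nonempty_F: "F s \<noteq> {}"
    and nested_F: "F (s @ [b]) \<subseteq> F s"
    and disjoint_F: "F (s @ [False]) \<inter> F (s @ [True]) = {}"
    and small_F: "x \<in> F (s @ [b]) \<Longrightarrow> y \<in> F (s @ [b]) \<Longrightarrow> dist x y \<le> (1/2) ^ length s"
begin

text \<open>Taking the union over each level first exhibits the set as an intersection of finite
  unions of closed sets. The description by branches is recovered in
  \<open>limit_set_iff\<close>.\<close>

definition limit_set :: "'x set" where
  "limit_set = (\<Inter>n. \<Union>s\<in>{s. length s = n}. F s)"

lemma F_initial_antimono: "m \<le> n \<Longrightarrow> F (initial f n) \<subseteq> F (initial f m)"
  by (rule lift_Suc_antimono_le) (auto simp: initial_Suc dest: subsetD [OF nested_F])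

text \<open>The threshold is uniform over all branches. It is \<open>Suc N\<close> because the bound
  for a word is governed by the length of its parent.\<close>

lemma small_initial:
  assumes "0 < e"
  obtains N where "\<And>f n x y. N \<le> n \<Longrightarrow> x \<in> F (initial f n) \<Longrightarrow> y \<in> F (initial f n) \<Longrightarrow> dist x y < e"
proof -
  obtain N where N: "(1/2::real) ^ N < e"
    using assms real_arch_pow_inv[of e "1/2"] by auto
  have "dist x y < e"
    if "Suc N \<le> n" and xy: "x \<in> F (initial f n)" "y \<in> F (initial f n)" for f n x y
  proof -
    have "x \<in> F (initial f (Suc N))" "y \<in> F (initial f (Suc N))"
      using F_initial_antimono[OF that(1)] xy by blast+
    then have "dist x y \<le> (1/2) ^ N"
      using small_F[of x "initial f N" "f N" y] by (simp add: initial_Suc)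
    then show ?thesis using N by simp
  qed
  then show ?thesis by (rule that)
qed

text \<open>Nestedness puts x into the sets of both parents, which coincide by induction;
  disjointness of siblings then forces equal last letters.\<close>

lemma F_inj: "length s = length t \<Longrightarrow> x \<in> F s \<Longrightarrow> x \<in> F t \<Longrightarrow> s = t"
proof (induction s arbitrary: t rule: rev_induct)
  case Nil
  then show ?case by simp
next
  case (snoc b s)
  then obtain c t' where t: "t = t' @ [c]"
    by (metis append_is_Nil_conv length_0_conv rev_exhaust)
  have "s = t'"
    using snoc t by (intro snoc.IH) (auto dest: subsetD [OF nested_F])
  moreover have "b = c"
    using disjoint_F[of s] snoc.prems t \<open>s = t'\<close> by (cases b; cases c) auto
  ultimately show ?case using t by simp
qed

text \<open>By \<open>F_inj\<close> a point lies in at most one set of each level, so the words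
  chosen at the various levels extend one another and glue to a branch.\<close>

lemma limit_set_iff: "x \<in> limit_set \<longleftrightarrow> (\<exists>f. \<forall>n. x \<in> F (initial f n))"
proof
  assume "x \<in> limit_set"
  then have "\<forall>n. \<exists>s. length s = n \<and> x \<in> F s"
    by (auto simp: limit_set_def)
  then obtain s where s: "\<And>n. length (s n) = n" "\<And>n. x \<in> F (s n)"
    by metis
  define f where "f k = last (s (Suc k))" for k
  have "initial f n = s n" for n
  proof (induction n)
    case 0
    then show ?case using s(1)[of 0] by simp
  next
    case (Suc n)
    obtain t b where t: "s (Suc n) = t @ [b]"
      using s(1)[of "Suc n"] by (metis length_Suc_conv_rev)
    have "x \<in> F t"
      using s(2)[of "Suc n"] nested_F[of t b] t by auto
    then have "t = s n"
      using t s(1)[of "Suc n"] s by (intro F_inj[of _ _ x]) simp_all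
    then show ?case using Suc t by (simp add: initial_Suc f_def)
  qed
  then show "\<exists>f. \<forall>n. x \<in> F (initial f n)"
    using s(2) by metis
next
  assume "\<exists>f. \<forall>n. x \<in> F (initial f n)"
  then show "x \<in> limit_set"
    by (force simp: limit_set_def)
qed

text \<open>This is Cantor's intersection theorem, hence the place where a scheme needs
  completeness.\<close>

lemma branch_nonempty: "\<exists>x. \<forall>n. x \<in> F (initial f n)"
proof -
  have "\<exists>x. x \<in> (\<Inter>n. F (initial f n))"
  proof (rule decreasing_closed_nest)
    fix e :: real assume "0 < e"
    then show "\<exists>n. \<forall>x\<in>F (initial f n). \<forall>y\<in>F (initial f n). dist x y < e"
      by (metis small_initial order_refl)
  qed (use closed_F nonempty_F F_initial_antimono in auto)
  then show ?thesis by auto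
qed

lemma closed_perfect_limit_set: "closed_perfect limit_set"
  unfolding closed_perfect_def
proof (intro conjI ballI)
  show "limit_set \<noteq> {}"
    using branch_nonempty limit_set_iff by blast
  have "finite {s :: bool list. length s = n}" for n
    using finite_lists_length_eq[of "UNIV :: bool set" n] by simp
  then show "closed limit_set"
    unfolding limit_set_def by (intro closed_INT ballI closed_UN) (auto simp: closed_F)
next
  fix x assume "x \<in> limit_set"
  then obtain f where f: "\<And>n. x \<in> F (initial f n)"
    by (auto simp: limit_set_iff)
  show "x islimpt limit_set"
    unfolding islimpt_approachable
  proof (intro allI impI)
    fix e :: real assume "0 < e"
    then obtain N where N: "\<And>f n x y. N \<le> n \<Longrightarrow> x \<in> F (initial f n) \<Longrightarrow> y \<in> F (initial f n) \<Longrightarrow> dist x y < e"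
      using small_initial by metis
    \<comment> \<open>Flipping entry N keeps the first N entries, so the new point stays within e of
      x, but it lies in a disjoint set of level N + 1.\<close>
    define g where "g = f(N := \<not> f N)"
    obtain y where y: "\<And>n. y \<in> F (initial g n)"
      using branch_nonempty by blast
    have eq: "initial g N = initial f N"
      by (rule initial_cong) (simp add: g_def)
    have "initial f (Suc N) \<noteq> initial g (Suc N)"
      by (simp add: initial_Suc g_def)
    then have "y \<noteq> x"
      using F_inj[of "initial f (Suc N)" "initial g (Suc N)" x] f y by auto
    moreover have "dist y x < e"
      using N[OF order_refl, of y f x] y[of N] f[of N] eq by simp
    ultimately show "\<exists>x'\<in>limit_set. x' \<noteq> x \<and> dist x' x < e"
      using y limit_set_iff by blast
  qed
qed

end

subsection \<open>Trees of words\<close>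

definition branches :: "'e list set \<Rightarrow> (nat \<Rightarrow> 'e) set" where
  "branches W = {\<phi>. \<forall>n. initial \<phi> n \<in> W}"

text \<open>This isolates what the tree of a winning strategy inherits from the opponent's options,
  so that both players are treated at once. Smallness is stated through distances, which avoids the
  diameter of unbounded sets.\<close>

locale splitting_tree =
  fixes W :: "'e list set" and I :: "'e list \<Rightarrow> 'x::complete_space set"
  assumes Nil_W: "[] \<in> W"
    and closed_I: "w \<in> W \<Longrightarrow> closed (I w)"
    and nonempty_I: "w \<in> W \<Longrightarrow> I w \<noteq> {}"
    and nested_I: "v \<in> W \<Longrightarrow> w \<in> W \<Longrightarrow> prefix v w \<Longrightarrow> I w \<subseteq> I v"
    and shrinks: "w \<in> W \<Longrightarrow> \<exists>\<phi>\<in>branches W. initial \<phi> (length w) = w \<and>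
          (\<forall>e>0. \<exists>n. \<forall>x\<in>I (initial \<phi> n). \<forall>y\<in>I (initial \<phi> n). dist x y < e)"
    and avoids: "w \<in> W \<Longrightarrow> \<exists>\<phi>\<in>branches W. initial \<phi> (length w) = w \<and> x \<notin> outcome I \<phi>"
begin

lemma I_initial_antimono: "\<phi> \<in> branches W \<Longrightarrow> m \<le> n \<Longrightarrow> I (initial \<phi> n) \<subseteq> I (initial \<phi> m)"
  by (intro nested_I prefix_initial) (auto simp: branches_def)

text \<open>Closure under prefixes comes for free: w lies on a branch, all of whose initial segments
  are in the tree.\<close>

lemma take_W: "w \<in> W \<Longrightarrow> take n w \<in> W"
proof -
  assume "w \<in> W"
  then obtain \<phi> where \<phi>: "\<phi> \<in> branches W" "initial \<phi> (length w) = w"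
    using shrinks by blast
  have "take n w = initial \<phi> (min n (length w))"
    by (metis \<phi>(2) length_initial min.cobounded2 take_all_iff take_initial min_def nle_le)
  then show ?thesis using \<phi>(1) by (simp add: branches_def)
qed

lemma small_extension:
  assumes "w \<in> W" "0 < (e::real)"
  obtains v where "v \<in> W" "prefix w v" "k \<le> length v" "\<And>x y. x \<in> I v \<Longrightarrow> y \<in> I v \<Longrightarrow> dist x y < e"
proof -
  obtain \<phi> n where \<phi>: "\<phi> \<in> branches W" "initial \<phi> (length w) = w"
    and n: "\<forall>x\<in>I (initial \<phi> n). \<forall>y\<in>I (initial \<phi> n). dist x y < e"
    using shrinks[OF assms(1)] assms(2) by metis
  define m where "m = max n (max k (length w))"
  have "prefix w (initial \<phi> m)"
    using prefix_initial[of "length w" m \<phi>] \<phi>(2) by (simp add: m_def)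
  moreover have "I (initial \<phi> m) \<subseteq> I (initial \<phi> n)"
    by (rule I_initial_antimono[OF \<phi>(1)]) (simp add: m_def)
  ultimately show ?thesis
    using n \<phi>(1) by (intro that[of "initial \<phi> m"]) (auto simp: branches_def m_def)
qed

text \<open>A shrinking branch through w has a common point x, and a second branch through w leaves
  x out of its set at some finite stage. That set is closed, so it misses a ball around x, and the
  first branch eventually stays inside this ball.\<close>

lemma disjoint_extensions:
  assumes "w \<in> W"
  obtains u v where "u \<in> W" "v \<in> W" "prefix w u" "prefix w v" "I u \<inter> I v = {}"
proof -
  obtain \<phi> where \<phi>: "\<phi> \<in> branches W" "initial \<phi> (length w) = w"
    and small: "\<And>e::real. 0 < e \<Longrightarrow> \<exists>n. \<forall>x\<in>I (initial \<phi> n). \<forall>y\<in>I (initial \<phi> n). dist x y < e"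
    using shrinks[OF assms] by metis
  have \<phi>W: "initial \<phi> n \<in> W" for n
    using \<phi>(1) by (simp add: branches_def)
  obtain x where x: "\<And>n. x \<in> I (initial \<phi> n)"
  proof (rule decreasing_closed_nest)
    show "closed (I (initial \<phi> n))" "I (initial \<phi> n) \<noteq> {}" for n
      using closed_I nonempty_I \<phi>W by blast+
    show "I (initial \<phi> n) \<subseteq> I (initial \<phi> m)" if "m \<le> n" for m n
      using I_initial_antimono[OF \<phi>(1) that] .
    show "\<exists>n. \<forall>x\<in>I (initial \<phi> n). \<forall>y\<in>I (initial \<phi> n). dist x y < e" if "0 < e" for e
      using small[OF that] .
  qed blast
  obtain \<psi> where \<psi>: "\<psi> \<in> branches W" "initial \<psi> (length w) = w" "x \<notin> outcome I \<psi>"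
    using avoids[OF assms] by blast
  then obtain k where k: "x \<notin> I (initial \<psi> k)"
    by (auto simp: outcome_def)
  \<comment> \<open>The maximum makes v an extension of w; passing to a longer word only shrinks the
    set, so x is still missed.\<close>
  define v where "v = initial \<psi> (max k (length w))"
  have v: "v \<in> W" "prefix w v" "x \<notin> I v"
    using \<psi> k I_initial_antimono[OF \<psi>(1), of k "max k (length w)"]
      prefix_initial[of "length w" "max k (length w)" \<psi>]
    by (auto simp: v_def branches_def)
  have "open (- I v)"
    using closed_I[OF v(1)] by (simp add: open_Compl)
  then obtain e where e: "0 < e" "ball x e \<subseteq> - I v"
    using v(3) by (auto simp: open_contains_ball)
  obtain n where n: "\<forall>x\<in>I (initial \<phi> n). \<forall>y\<in>I (initial \<phi> n). dist x y < e"
    using small e(1) by blast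
  define u where "u = initial \<phi> (max n (length w))"
  have "I u \<subseteq> I (initial \<phi> n)"
    unfolding u_def by (rule I_initial_antimono[OF \<phi>(1)]) simp
  also have "\<dots> \<subseteq> ball x e"
    using n x[of n] by auto
  finally have "I u \<inter> I v = {}"
    using e(2) by auto
  moreover have "prefix w u"
    using prefix_initial[of "length w" "max n (length w)" \<phi>] \<phi>(2) by (simp add: u_def)
  ultimately show ?thesis
    using that v \<phi>W u_def by blast
qed

text \<open>Separate first, then shrink each side; shrinking preserves disjointness. The strict
  growth in length lets the length of w serve as the stage counter for the required size.\<close>

lemma exists_split:
  assumes "w \<in> W"
  shows "\<exists>h :: bool \<Rightarrow> 'e list. (\<forall>b. h b \<in> W \<and> prefix w (h b) \<and> length w < length (h b) \<and>
      (\<forall>x\<in>I (h b). \<forall>y\<in>I (h b). dist x y < (1/2) ^ length w)) \<and> I (h False) \<inter> I (h True) = {}"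
proof -
  obtain u v where uv: "u \<in> W" "v \<in> W" "prefix w u" "prefix w v" "I u \<inter> I v = {}"
    using disjoint_extensions[OF assms] by blast
  have e: "(0::real) < (1/2) ^ length w" by simp
  obtain u' where u': "u' \<in> W" "prefix u u'" "Suc (length w) \<le> length u'"
    "\<And>x y. x \<in> I u' \<Longrightarrow> y \<in> I u' \<Longrightarrow> dist x y < (1/2) ^ length w"
    using small_extension[OF uv(1) e, where k = "Suc (length w)"] by blast
  obtain v' where v': "v' \<in> W" "prefix v v'" "Suc (length w) \<le> length v'"
    "\<And>x y. x \<in> I v' \<Longrightarrow> y \<in> I v' \<Longrightarrow> dist x y < (1/2) ^ length w"
    using small_extension[OF uv(2) e, where k = "Suc (length w)"] by blast
  have "I u' \<inter> I v' = {}"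
    using uv(5) nested_I[OF uv(1) u'(1,2)] nested_I[OF uv(2) v'(1,2)] by blast
  then show ?thesis
    using u' v' uv by (intro exI[of _ "\<lambda>b. if b then v' else u'"]) (auto intro: prefix_order.trans)
qed

lemma exists_perfect:
  assumes T: "\<And>\<phi> x. \<phi> \<in> branches W \<Longrightarrow> outcome I \<phi> = {x} \<Longrightarrow> x \<in> T"
  shows "\<exists>P. closed_perfect P \<and> P \<subseteq> T"
proof -
  obtain g :: "'e list \<Rightarrow> bool \<Rightarrow> 'e list" where
    g: "\<And>w b. w \<in> W \<Longrightarrow> g w b \<in> W \<and> prefix w (g w b) \<and> length w < length (g w b)"
    and small: "\<And>w b x y. \<lbrakk>w \<in> W; x \<in> I (g w b); y \<in> I (g w b)\<rbrakk> \<Longrightarrow> dist x y < (1/2) ^ length w"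
    and disj: "\<And>w. w \<in> W \<Longrightarrow> I (g w False) \<inter> I (g w True) = {}"
    using exists_split by metis
  \<comment> \<open>The fold reads the index word from the left and descends to the chosen child at
    each letter, starting from the empty word.\<close>
  define K where "K = foldl g []"
  have K_snoc: "K (s @ [b]) = g (K s) b" for s b
    by (simp add: K_def)
  have K: "K s \<in> W \<and> length s \<le> length (K s)" for s
  proof (induction s rule: rev_induct)
    case Nil
    then show ?case by (simp add: K_def Nil_W)
  next
    case (snoc b s)
    then show ?case using g[of "K s" b] by (simp add: K_snoc)
  qed
  interpret cantor_scheme "\<lambda>s. I (K s)"
  proof
    fix s b x y
    show "closed (I (K s))" "I (K s) \<noteq> {}"
      using K closed_I nonempty_I by blast+
    show "I (K (s @ [b])) \<subseteq> I (K s)"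
      using K g nested_I by (simp add: K_snoc)
    show "I (K (s @ [False])) \<inter> I (K (s @ [True])) = {}"
      using K disj by (simp add: K_snoc)
    assume "x \<in> I (K (s @ [b]))" "y \<in> I (K (s @ [b]))"
    then have "dist x y < (1/2) ^ length (K s)"
      using K small by (simp add: K_snoc)
    \<comment> \<open>\<open>K s\<close> is at least as long as \<open>s\<close>, so the bound in
      terms of word length is at least as good as the one in terms of level.\<close>
    also have "\<dots> \<le> (1/2) ^ length s"
      using K by (intro power_decreasing) auto
    finally show "dist x y \<le> (1/2) ^ length s" by simp
  qed
  have "x \<in> T" if "x \<in> limit_set" for x
  proof -
    obtain f where f: "\<And>n. x \<in> I (K (initial f n))"
      using \<open>x \<in> limit_set\<close> by (auto simp: limit_set_iff)
    \<comment> \<open>The words along the branch may grow by several letters at a time. The one at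
      level k + 1 has length at least k + 1, so its entry k is defined.\<close>
    define \<phi> where "\<phi> k = K (initial f (Suc k)) ! k" for k
    have mono: "prefix (K (initial f m)) (K (initial f n))" if "m \<le> n" for m n
      using that
    proof (induction rule: dec_induct)
      case (step n)
      then show ?case
        using g[of "K (initial f n)" "f n"] K by (simp add: initial_Suc K_snoc)
           (meson prefix_order.trans)
    qed simp
    have \<phi>_nth: "\<phi> k = K (initial f n) ! k" if "k < length (K (initial f n))" for k n
    proof -
      have "k < length (K (initial f (Suc k)))"
        using K[of "initial f (Suc k)"] by simp
      then show ?thesis
        unfolding \<phi>_def using mono[of n "Suc k"] mono[of "Suc k" n] that
        by (metis nle_le nth_append prefix_def)
    qed
    have \<phi>_K: "initial \<phi> (length (K (initial f n))) = K (initial f n)" for n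
      by (simp add: list_eq_iff_nth_eq \<phi>_nth)
    have \<phi>_take: "initial \<phi> n = take n (K (initial f n))" for n
      using K[of "initial f n"] by (metis \<phi>_K length_initial take_initial)
    have "\<phi> \<in> branches W"
      using K take_W by (auto simp: branches_def \<phi>_take)
    \<comment> \<open>The words \<open>K (initial f n)\<close> are cofinal among the initial
      segments of \<phi>, so the outcome is the intersection along the branch f of the scheme, and
      that has only one point.\<close>
    moreover have "outcome I \<phi> = {x}"
    proof (intro set_eqI iffI)
      fix y assume "y \<in> outcome I \<phi>"
      then have y: "y \<in> I (K (initial f n))" for n
        unfolding outcome_def using \<phi>_K[of n] by (metis INT_E UNIV_I)
      have "dist y x < e" if "0 < e" for e
        using small_initial[OF that] f y by (metis order_refl)
      then show "y \<in> {x}"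
        by (metis dist_pos_lt less_irrefl singletonI)
    next
      fix y assume "y \<in> {x}"
      moreover have "I (K (initial f n)) \<subseteq> I (initial \<phi> n)" for n
        unfolding \<phi>_take using K take_W nested_I take_is_prefix by metis
      ultimately show "y \<in> outcome I \<phi>"
        using f by (auto simp: outcome_def)
    qed
    ultimately show ?thesis by (rule T)
  qed
  then show ?thesis
    using closed_perfect_limit_set by blast
qed

end

subsection \<open>Plays consistent with a strategy\<close>

lemma legal_words_Nil [simp]: "[] \<in> legal_words E \<Gamma>"
  by (simp add: legal_words_def)

lemma legal_words_snoc:
  "w @ [a] \<in> legal_words E \<Gamma> \<longleftrightarrow> w \<in> legal_words E \<Gamma> \<and> a \<in> E \<and> a \<in> \<Gamma> w"
  by (auto simp: legal_words_def nth_append less_Suc_eq)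

lemma legal_words_take: "w \<in> legal_words E \<Gamma> \<Longrightarrow> take n w \<in> legal_words E \<Gamma>"
  by (auto simp: legal_words_def min_def dest: in_set_takeD)

lemma legal_inf_words_iff: "\<phi> \<in> legal_inf_words E \<Gamma> \<longleftrightarrow> \<phi> \<in> branches (legal_words E \<Gamma>)"
proof
  assume *: "\<phi> \<in> legal_inf_words E \<Gamma>"
  have "initial \<phi> n \<in> legal_words E \<Gamma>" for n
    using * by (induction n) (auto simp: initial_Suc legal_words_snoc legal_inf_words_def)
  then show "\<phi> \<in> branches (legal_words E \<Gamma>)"
    by (simp add: branches_def)
next
  assume "\<phi> \<in> branches (legal_words E \<Gamma>)"
  then have "initial \<phi> (Suc n) \<in> legal_words E \<Gamma>" for n
    by (simp add: branches_def)
  then show "\<phi> \<in> legal_inf_words E \<Gamma>"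
    by (auto simp: initial_Suc legal_words_snoc legal_inf_words_def)
qed

section \<open>Plays generated by a pair of strategies\<close>

lemma length_play_steps [simp]: "length (play_steps \<tau> \<sigma>A \<sigma>B n) = length \<tau> + n"
  by (induction n) (auto simp: Let_def)

lemma prefix_play_steps: "m \<le> n \<Longrightarrow> prefix (play_steps \<tau> \<sigma>A \<sigma>B m) (play_steps \<tau> \<sigma>A \<sigma>B n)"
proof (induction rule: dec_induct)
  case (step n)
  then show ?case by (simp add: Let_def)
qed simp

text \<open>\<open>play\<close> reads entry k off the word after k + 1 moves. Of that word and the
  one after n moves, one is a prefix of the other, so the entries agree.\<close>

lemma initial_play: "initial (play \<tau> \<sigma>A \<sigma>B) (length \<tau> + n) = play_steps \<tau> \<sigma>A \<sigma>B n"
proof (rule nth_equalityI)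
  fix k assume "k < length (initial (play \<tau> \<sigma>A \<sigma>B) (length \<tau> + n))"
  then have k: "k < length \<tau> + n" by simp
  have "play_steps \<tau> \<sigma>A \<sigma>B (Suc k) ! k = play_steps \<tau> \<sigma>A \<sigma>B n ! k"
    using prefix_play_steps[of "Suc k" n \<tau> \<sigma>A \<sigma>B] prefix_play_steps[of n "Suc k" \<tau> \<sigma>A \<sigma>B] k
    by (cases "Suc k \<le> n") (auto simp: prefix_def nth_append simp del: play_steps.simps)
  then show "initial (play \<tau> \<sigma>A \<sigma>B) (length \<tau> + n) ! k = play_steps \<tau> \<sigma>A \<sigma>B n ! k"
    using k by (simp add: play_def del: play_steps.simps)
qed simp

lemma initial_play_length: "initial (play \<tau> \<sigma>A \<sigma>B) (length \<tau>) = \<tau>"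
  using initial_play[of \<tau> \<sigma>A \<sigma>B 0] by simp

lemma play_move:
  assumes "length \<tau> \<le> n"
  shows "play \<tau> \<sigma>A \<sigma>B n = (if even n then \<sigma>B else \<sigma>A) (initial (play \<tau> \<sigma>A \<sigma>B) n)"
proof -
  obtain m where m: "n = length \<tau> + m"
    using assms le_Suc_ex by blast
  show ?thesis
    using initial_play[of \<tau> \<sigma>A \<sigma>B "Suc m"] initial_play[of \<tau> \<sigma>A \<sigma>B m]
    by (auto simp: initial_Suc Let_def m)
qed

text \<open>The predicate \<open>p\<close> tells at which positions the player using \<open>\<sigma>\<close> is to move.\<close>

definition consistent_words ::
    "'e set \<Rightarrow> ('e list \<Rightarrow> 'e set) \<Rightarrow> (nat \<Rightarrow> bool) \<Rightarrow> ('e list \<Rightarrow> 'e) \<Rightarrow> 'e list set" where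
  "consistent_words E \<Gamma> p \<sigma> =
     {w \<in> legal_words E \<Gamma>. \<forall>n<length w. p n \<longrightarrow> w ! n = \<sigma> (take n w)}"

lemma consistent_words_take:
  "w \<in> consistent_words E \<Gamma> p \<sigma> \<Longrightarrow> take n w \<in> consistent_words E \<Gamma> p \<sigma>"
  by (auto simp: consistent_words_def legal_words_take min_def)

text \<open>With p being \<open>odd\<close> or \<open>even\<close>, the right-hand side is the
  condition on plays in \<open>alice_winning\<close> or \<open>bob_winning\<close>.\<close>

lemma branches_consistent_words:
  "\<phi> \<in> branches (consistent_words E \<Gamma> p \<sigma>) \<longleftrightarrow>
     \<phi> \<in> legal_inf_words E \<Gamma> \<and> (\<forall>n. p n \<longrightarrow> \<phi> n = \<sigma> (initial \<phi> n))"
  (is "?L \<longleftrightarrow> ?R")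
proof
  assume L: ?L
  have "\<phi> n = \<sigma> (initial \<phi> n)" if "p n" for n
  proof -
    have "initial \<phi> (Suc n) \<in> consistent_words E \<Gamma> p \<sigma>"
      using L by (simp add: branches_def)
    then have "initial \<phi> (Suc n) ! n = \<sigma> (take n (initial \<phi> (Suc n)))"
      unfolding consistent_words_def using that
      by (metis (mono_tags, lifting) length_initial lessI mem_Collect_eq)
    then show ?thesis by (simp add: take_initial)
  qed
  then show ?R using L
    by (auto simp: legal_inf_words_iff branches_def consistent_words_def)
next
  assume ?R
  then show ?L
    by (auto simp: legal_inf_words_iff branches_def consistent_words_def take_initial)
qed

text \<open>Up to the length of w, consistency is inherited from w; beyond it, every move is made by
  the prescribed strategy. The last assumption says that \<sigma> is the strategy of whoever moves
  at the positions in p.\<close>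

lemma play_consistent:
  assumes \<Gamma>: "ruleset E \<Gamma>"
    and A: "alice_strategy E \<Gamma> \<sigma>A" and B: "bob_strategy E \<Gamma> \<sigma>B"
    and w: "w \<in> consistent_words E \<Gamma> p \<sigma>"
    and p: "\<And>n. p n \<Longrightarrow> \<sigma> = (if even n then \<sigma>B else \<sigma>A)"
  shows "play w \<sigma>A \<sigma>B \<in> branches (consistent_words E \<Gamma> p \<sigma>)"
proof -
  let ?\<phi> = "play w \<sigma>A \<sigma>B"
  have short: "initial ?\<phi> n \<in> consistent_words E \<Gamma> p \<sigma>" if "n \<le> length w" for n
    using consistent_words_take[OF w, of n] take_initial[OF that, of ?\<phi>]
    by (simp add: initial_play_length)
  have long: "initial ?\<phi> (length w + n) \<in> consistent_words E \<Gamma> p \<sigma>" for n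
  proof (induction n)
    case 0
    then show ?case using short by simp
  next
    case (Suc n)
    let ?m = "length w + n"
    have legal: "initial ?\<phi> ?m \<in> legal_words E \<Gamma>"
      using Suc by (simp add: consistent_words_def)
    have move: "?\<phi> ?m = (if even ?m then \<sigma>B else \<sigma>A) (initial ?\<phi> ?m)"
      by (rule play_move) simp
    have "(if even ?m then \<sigma>B else \<sigma>A) (initial ?\<phi> ?m) \<in> \<Gamma> (initial ?\<phi> ?m)"
      using A B legal by (auto simp: alice_strategy_def bob_strategy_def)
    then have "?\<phi> ?m \<in> \<Gamma> (initial ?\<phi> ?m)"
      by (simp only: move)
    moreover have "\<Gamma> (initial ?\<phi> ?m) \<subseteq> E"
      using \<Gamma> legal unfolding ruleset_def legal_words_def by blast
    ultimately have "initial ?\<phi> ?m @ [?\<phi> ?m] \<in> legal_words E \<Gamma>"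
      using legal unfolding legal_words_snoc by blast
    moreover have "p ?m \<Longrightarrow> ?\<phi> ?m = \<sigma> (initial ?\<phi> ?m)"
      using move p[of ?m] by simp
    ultimately show ?case
      using Suc by (auto simp: consistent_words_def initial_Suc nth_append less_Suc_eq)
  qed
  have "initial ?\<phi> n \<in> consistent_words E \<Gamma> p \<sigma>" for n
    using short[of n] long[of "n - length w"] by (cases "n \<le> length w") auto
  then show ?thesis by (simp add: branches_def)
qed

section \<open>From winning strategies to perfect sets\<close>

lemma Z_set_small:
  assumes "\<phi> \<in> Z_set E \<Gamma> I" "0 < e"
  shows "\<exists>n. \<forall>x\<in>I (initial \<phi> n). \<forall>y\<in>I (initial \<phi> n). dist x y < e"
proof -
  have "\<forall>\<^sub>F n in sequentially. diameter (I (initial \<phi> n)) < e"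
    using assms by (auto simp: Z_set_def intro: order_tendstoD)
  \<comment> \<open>A small \<open>diameter\<close> controls distances only on a bounded set, so
    both properties must hold at the same n.\<close>
  then have "\<forall>\<^sub>F n in sequentially. bounded (I (initial \<phi> n)) \<and> diameter (I (initial \<phi> n)) < e"
    using assms(1) by (auto simp: Z_set_def intro: eventually_conj)
  then obtain n where "bounded (I (initial \<phi> n))" "diameter (I (initial \<phi> n)) < e"
    using eventually_happens'[OF sequentially_bot] by blast
  then show ?thesis
    by (metis diameter_bounded_bound le_less_trans)
qed

text \<open>The players differ only in how \<open>ensure\<close> is proved. It is applied with T
  being \<open>Z_set\<close> for shrinking and \<open>N_set\<close> for avoiding a point.\<close>

lemma splitting_tree_consistent:
  assumes G: "game E \<Gamma> I" "shrinking E \<Gamma> I" "nondegenerate E \<Gamma> I"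
    and ensure: "\<And>w T. w \<in> consistent_words E \<Gamma> p \<sigma> \<Longrightarrow> both_can_ensure E \<Gamma> T w \<Longrightarrow>
        \<exists>\<phi>\<in>branches (consistent_words E \<Gamma> p \<sigma>). initial \<phi> (length w) = w \<and> \<phi> \<in> T"
  shows "splitting_tree (consistent_words E \<Gamma> p \<sigma>) I"
proof
  have legal: "w \<in> legal_words E \<Gamma>" if "w \<in> consistent_words E \<Gamma> p \<sigma>" for w
    using that by (simp add: consistent_words_def)
  show "[] \<in> consistent_words E \<Gamma> p \<sigma>"
    by (simp add: consistent_words_def)
  fix w assume w: "w \<in> consistent_words E \<Gamma> p \<sigma>"
  show "closed (I w)" "I w \<noteq> {}"
    using G(1) legal[OF w] by (auto simp: game_def topological_interpretation_def)
  show "I w \<subseteq> I v" if "v \<in> consistent_words E \<Gamma> p \<sigma>" "prefix v w" for v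
    using G(1) legal[OF w] legal[OF that(1)] that(2)
    unfolding game_def topological_interpretation_def by blast
  show "\<exists>\<phi>\<in>branches (consistent_words E \<Gamma> p \<sigma>). initial \<phi> (length w) = w \<and>
      (\<forall>e>0. \<exists>n. \<forall>x\<in>I (initial \<phi> n). \<forall>y\<in>I (initial \<phi> n). dist x y < e)"
    using ensure[OF w, of "Z_set E \<Gamma> I"] G(2) legal[OF w] Z_set_small
    unfolding shrinking_def by metis
  show "\<exists>\<phi>\<in>branches (consistent_words E \<Gamma> p \<sigma>). initial \<phi> (length w) = w \<and> x \<notin> outcome I \<phi>" for x
    using ensure[OF w, of "N_set E \<Gamma> I x"] G(3) legal[OF w]
    unfolding nondegenerate_def N_set_def by blast
qed

lemma alice_winning_imp_perfect:
  fixes I :: "'e list \<Rightarrow> 'x::complete_space set"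
  assumes G: "game E \<Gamma> I" "shrinking E \<Gamma> I" "nondegenerate E \<Gamma> I"
    and win: "alice_winning E \<Gamma> I S \<sigma>A"
  shows "\<exists>P. closed_perfect P \<and> P \<subseteq> S"
proof -
  interpret splitting_tree "consistent_words E \<Gamma> odd \<sigma>A" I
  proof (rule splitting_tree_consistent[OF G])
    fix w T assume w: "w \<in> consistent_words E \<Gamma> odd \<sigma>A" and "both_can_ensure E \<Gamma> T w"
    \<comment> \<open>Only the opponent's half of \<open>both_can_ensure\<close> is taken; his
      strategy is played against \<sigma>A from w onwards.\<close>
    then obtain \<sigma>B where \<sigma>B: "bob_strategy E \<Gamma> \<sigma>B" "bob_ensures E \<Gamma> \<sigma>B T w"
      by (auto simp: both_can_ensure_def)
    have \<sigma>A: "alice_strategy E \<Gamma> \<sigma>A"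
      using win by (simp add: alice_winning_def)
    show "\<exists>\<phi>\<in>branches (consistent_words E \<Gamma> odd \<sigma>A). initial \<phi> (length w) = w \<and> \<phi> \<in> T"
      using play_consistent[OF _ \<sigma>A \<sigma>B(1) w] \<sigma>A \<sigma>B(2) G(1) initial_play_length
      by (metis bob_ensures_def game_def)
  qed
  show ?thesis
    \<comment> \<open>A consistent play is won by Alice, so an outcome that is a single point must
      lie in S.\<close>
    using win by (intro exists_perfect) (force simp: branches_consistent_words alice_winning_def)
qed

lemma bob_winning_imp_perfect:
  fixes I :: "'e list \<Rightarrow> 'x::complete_space set"
  assumes G: "game E \<Gamma> I" "shrinking E \<Gamma> I" "nondegenerate E \<Gamma> I"
    and win: "bob_winning E \<Gamma> I S \<sigma>B"
  shows "\<exists>P. closed_perfect P \<and> P \<subseteq> UNIV - S"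
proof -
  interpret splitting_tree "consistent_words E \<Gamma> even \<sigma>B" I
  proof (rule splitting_tree_consistent[OF G])
    fix w T assume w: "w \<in> consistent_words E \<Gamma> even \<sigma>B" and "both_can_ensure E \<Gamma> T w"
    then obtain \<sigma>A where \<sigma>A: "alice_strategy E \<Gamma> \<sigma>A" "alice_ensures E \<Gamma> \<sigma>A T w"
      by (auto simp: both_can_ensure_def)
    have \<sigma>B: "bob_strategy E \<Gamma> \<sigma>B"
      using win by (simp add: bob_winning_def)
    show "\<exists>\<phi>\<in>branches (consistent_words E \<Gamma> even \<sigma>B). initial \<phi> (length w) = w \<and> \<phi> \<in> T"
      using play_consistent[OF _ \<sigma>A(1) \<sigma>B w] \<sigma>B \<sigma>A(2) G(1) initial_play_length
      by (metis alice_ensures_def game_def)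
  qed
  show ?thesis
    \<comment> \<open>Here the single outcome is disjoint from S, which places its point in the
      complement.\<close>
    using win by (intro exists_perfect) (force simp: branches_consistent_words bob_winning_def)
qed

theorem theorem3p6:
  fixes E :: "'e set"
    and \<Gamma> :: "'e list \<Rightarrow> 'e set"
    and I :: "'e list \<Rightarrow> 'x::complete_space set"
    and S :: "'x set"
  assumes "game E \<Gamma> I"
    and "shrinking E \<Gamma> I"
    and "nondegenerate E \<Gamma> I"
  shows "((\<exists>\<sigma>A. alice_winning E \<Gamma> I S \<sigma>A) \<longrightarrow> (\<exists>P. closed_perfect P \<and> P \<subseteq> S)) \<and>
         ((\<exists>\<sigma>B. bob_winning E \<Gamma> I S \<sigma>B) \<longrightarrow> (\<exists>P. closed_perfect P \<and> P \<subseteq> UNIV - S)) \<and>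
         (bernstein S \<longrightarrow> \<not> determined E \<Gamma> I S)"
proof -
  have A: "\<exists>P. closed_perfect P \<and> P \<subseteq> S" if "alice_winning E \<Gamma> I S \<sigma>A" for \<sigma>A
    using alice_winning_imp_perfect[OF assms that] .
  have B: "\<exists>P. closed_perfect P \<and> P \<subseteq> UNIV - S" if "bob_winning E \<Gamma> I S \<sigma>B" for \<sigma>B
    using bob_winning_imp_perfect[OF assms that] .
  have "\<not> determined E \<Gamma> I S" if "bernstein S"
    using A B that unfolding determined_def bernstein_def by blast
  then show ?thesis using A B by blast
qed

end
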